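(* Let $G$ be a group and let $d\ge2$. Then the commutative nerve $N(\mathbb Z,G)$ and the $d$-torsion commutative nerve $N(\mathbb Z_{/d},G)$ are (nerves of) weakly associative partial groups.
   Context: $N(\mathbb Z,G)$ is the simplicial subset of the nerve of $G$ with $n$-simplices the tuples $(g_1,\dots,g_n)\in G^n$ of pairwise commuting elements; $N(\mathbb Z_{/d},G)$ is the simplicial subset of those tuples with moreover $g_i^d=1$ for all $i$. (In the nerve of $G$, $d_0,d_n$ drop the first/last entry, $d_i$ multiplies the $i$-th and $(i+1)$-st entries for $0<i<n$, and $s_i$ inserts $1$.) A partial unital magma $(M,\cdot,1)$ is a set $M$ with a partially defined binary operation $\cdot$ (pairs in its domain are called multiplicable) and an element $1$ such that $(m,1),(1,m)$ are multiplicable with $m\cdot1=m=1\cdot m$ for all $m\in M$. For $n\ge2$, a bracketing $T$ (planar binary rooted tree with $n$ leaves) gives a partial $n$-ary operation $\cdot^T$; an $n$-tuple is multiplicable if it is in the domain of $\cdot^T$ for all $T$, and associable if moreover all the products $\cdot^T$ agree; a tuple $(b_1,\dots,b_n)$ is fully associable if it is associable and all $(b_i,\dots,b_j)$, $1\le i<j\le n$, are associable (1-tuples and the empty tuple are regarded as fully associable). A weak partial monoid is a partial unital magma in which every multiplicable tuple is associable. It has inverses if every $m$ has an element $m^{-1}$ such that $(m,m^{-1})$, $(m^{-1},m)$ are multiplicable with products $1$. A weakly associative partial group is a weak partial monoid $M$ with inverses such that for every fully associable tuple $(g_1,\dots,g_n)$ the tuple $(g_1,\dots,g_n,g_n^{-1},\dots,g_1^{-1})$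 is fully associable. The nerve $N(M)$ of a weak partial monoid $M$ is the simplicial set with $N(M)_n$ the set of fully associable $n$-tuples ($N(M)_0$ a point, $N(M)_1=M$); $d_0,d_n$ drop the first/last entry, $d_i$ multiplies the $i$-th and $(i+1)$-st entries for $0<i<n$, and $s_i$ inserts $1$. The nerve is fully faithful, and weak partial monoids are identified with their nerves; a simplicial set is called a weakly associative partial group if it is isomorphic to the nerve of one. *)

theory Defs
  imports "HOL-Algebra.Group"
begin

text \<open>The second argument of \<open>face\<close> and \<open>degen\<close> is the simplicial index; the first one is the
  dimension of the simplex the operator is applied to.\<close>

record 'x sset =
  simplices :: "nat \<Rightarrow> 'x set"
  face :: "nat \<Rightarrow> nat \<Rightarrow> 'x \<Rightarrow> 'x"
  degen :: "nat \<Rightarrow> nat \<Rightarrow> 'x \<Rightarrow> 'x"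

locale simplicial_set =
  fixes X :: "'x sset"
  assumes face_closed:
      "\<lbrakk>x \<in> simplices X (Suc n); i \<le> Suc n\<rbrakk> \<Longrightarrow> face X (Suc n) i x \<in> simplices X n"
    and degen_closed:
      "\<lbrakk>x \<in> simplices X n; i \<le> n\<rbrakk> \<Longrightarrow> degen X n i x \<in> simplices X (Suc n)"
    and face_face:
      "\<lbrakk>x \<in> simplices X (Suc (Suc n)); i < j; j \<le> Suc (Suc n)\<rbrakk> \<Longrightarrow>
        face X (Suc n) i (face X (Suc (Suc n)) j x)
          = face X (Suc n) (j - 1) (face X (Suc (Suc n)) i x)"
    and face_degen_less:
      "\<lbrakk>x \<in> simplices X n; i < j; j \<le> n\<rbrakk> \<Longrightarrow>
        face X (Suc n) i (degen X n j x) = degen X (n - 1) (j - 1) (face X n i x)"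
    and face_degen_same:
      "\<lbrakk>x \<in> simplices X n; j \<le> n\<rbrakk> \<Longrightarrow> face X (Suc n) j (degen X n j x) = x"
    and face_degen_Suc:
      "\<lbrakk>x \<in> simplices X n; j \<le> n\<rbrakk> \<Longrightarrow> face X (Suc n) (Suc j) (degen X n j x) = x"
    and face_degen_greater:
      "\<lbrakk>x \<in> simplices X n; Suc j < i; i \<le> Suc n\<rbrakk> \<Longrightarrow>
        face X (Suc n) i (degen X n j x) = degen X (n - 1) j (face X n (i - 1) x)"
    and degen_degen:
      "\<lbrakk>x \<in> simplices X n; i \<le> j; j \<le> n\<rbrakk> \<Longrightarrow>
        degen X (Suc n) i (degen X n j x) = degen X (Suc n) (Suc j) (degen X n i x)"

locale simplicial_map = dom: simplicial_set X + cod: simplicial_set Y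
  for X :: "'x sset" and Y :: "'y sset" +
  fixes f :: "nat \<Rightarrow> 'x \<Rightarrow> 'y"
  assumes map_closed: "x \<in> simplices X n \<Longrightarrow> f n x \<in> simplices Y n"
    and map_face:
      "\<lbrakk>x \<in> simplices X (Suc n); i \<le> Suc n\<rbrakk> \<Longrightarrow>
        f n (face X (Suc n) i x) = face Y (Suc n) i (f (Suc n) x)"
    and map_degen:
      "\<lbrakk>x \<in> simplices X n; i \<le> n\<rbrakk> \<Longrightarrow> f (Suc n) (degen X n i x) = degen Y n i (f n x)"

definition sset_iso :: "'x sset \<Rightarrow> 'y sset \<Rightarrow> bool" where
  "sset_iso X Y \<longleftrightarrow>
    (\<exists>f. simplicial_map X Y f \<and> (\<forall>n. bij_betw (f n) (simplices X n) (simplices Y n)))"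

text \<open>\<open>pmult M x y = None\<close> means that \<open>(x, y)\<close> is not multiplicable. Only the values of
  \<open>pmult M\<close> on elements of the carrier are significant.\<close>

record 'a partial_magma = "'a partial_object" +
  pmult :: "'a \<Rightarrow> 'a \<Rightarrow> 'a option"
  punit :: 'a

locale partial_unital_magma =
  fixes M :: "'a partial_magma"
  assumes pmult_closed:
      "\<lbrakk>x \<in> carrier M; y \<in> carrier M; pmult M x y = Some z\<rbrakk> \<Longrightarrow> z \<in> carrier M"
    and punit_closed: "punit M \<in> carrier M"
    and punit_right: "m \<in> carrier M \<Longrightarrow> pmult M m (punit M) = Some m"
    and punit_left: "m \<in> carrier M \<Longrightarrow> pmult M (punit M) m = Some m"

datatype bracketing = Leaf | Join bracketing bracketing

fun leaves :: "bracketing \<Rightarrow> nat" where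
  "leaves Leaf = 1"
| "leaves (Join S T) = leaves S + leaves T"

text \<open>The partial operation of a bracketing, for a tuple with as many entries as the bracketing has
  leaves.\<close>

fun bprod :: "'a partial_magma \<Rightarrow> bracketing \<Rightarrow> 'a list \<Rightarrow> 'a option" where
  "bprod M Leaf xs = Some (hd xs)"
| "bprod M (Join S T) xs =
    Option.bind (bprod M S (take (leaves S) xs)) (\<lambda>a.
    Option.bind (bprod M T (drop (leaves S) xs)) (\<lambda>b. pmult M a b))"

definition multiplicable :: "'a partial_magma \<Rightarrow> 'a list \<Rightarrow> bool" where
  "multiplicable M xs \<longleftrightarrow>
    2 \<le> length xs \<and> set xs \<subseteq> carrier M \<and>
    (\<forall>T. leaves T = length xs \<longrightarrow> bprod M T xs \<noteq> None)"

definition associable :: "'a partial_magma \<Rightarrow> 'a list \<Rightarrow> bool" where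
  "associable M xs \<longleftrightarrow>
    multiplicable M xs \<and>
    (\<forall>S T. leaves S = length xs \<and> leaves T = length xs \<longrightarrow> bprod M S xs = bprod M T xs)"

text \<open>Entries are indexed from \<open>0\<close>, so \<open>take (Suc j - i) (drop i xs)\<close> is the tuple of the entries of
  \<open>xs\<close> at the positions \<open>i, \<dots>, j\<close>.\<close>

definition fully_associable :: "'a partial_magma \<Rightarrow> 'a list \<Rightarrow> bool" where
  "fully_associable M xs \<longleftrightarrow>
    set xs \<subseteq> carrier M \<and>
    (2 \<le> length xs \<longrightarrow>
      associable M xs \<and>
      (\<forall>i j. i < j \<and> j < length xs \<longrightarrow> associable M (take (Suc j - i) (drop i xs))))"

locale weak_partial_monoid = partial_unital_magma +
  assumes multiplicable_associable: "multiplicable M xs \<Longrightarrow> associable M xs"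

definition is_pinverse :: "'a partial_magma \<Rightarrow> 'a \<Rightarrow> 'a \<Rightarrow> bool" where
  "is_pinverse M m m' \<longleftrightarrow>
    m' \<in> carrier M \<and> pmult M m m' = Some (punit M) \<and> pmult M m' m = Some (punit M)"

text \<open>In a weak partial monoid inverses are unique: if \<open>m'\<close> and \<open>m''\<close> are inverses of \<open>m\<close>, then
  \<open>(m', m, m'')\<close> is multiplicable, hence associable, with products \<open>m''\<close> and \<open>m'\<close>.\<close>

definition pinverse :: "'a partial_magma \<Rightarrow> 'a \<Rightarrow> 'a" where
  "pinverse M m = (THE m'. is_pinverse M m m')"

locale weakly_associative_partial_group = weak_partial_monoid +
  assumes has_inverses: "m \<in> carrier M \<Longrightarrow> \<exists>m'. is_pinverse M m m'"
    and fully_associable_inverses: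
      "fully_associable M gs \<Longrightarrow> fully_associable M (gs @ rev (map (pinverse M) gs))"

text \<open>The operators of the bar construction for a binary operation \<open>f\<close> with unit \<open>e\<close>. The entries
  \<open>g\<^sub>i\<close> and \<open>g\<^sub>i\<^sub>+\<^sub>1\<close> of \<open>(g\<^sub>1, \<dots>, g\<^sub>n)\<close> sit at the list positions \<open>i - 1\<close> and \<open>i\<close>.\<close>

definition bar_face :: "('a \<Rightarrow> 'a \<Rightarrow> 'a) \<Rightarrow> nat \<Rightarrow> nat \<Rightarrow> 'a list \<Rightarrow> 'a list" where
  "bar_face f n i xs =
    (if i = 0 then tl xs
     else if i = n then butlast xs
     else take (i - 1) xs @ [f (xs ! (i - 1)) (xs ! i)] @ drop (i + 1) xs)"

definition bar_degen :: "'a \<Rightarrow> nat \<Rightarrow> nat \<Rightarrow> 'a list \<Rightarrow> 'a list" where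
  "bar_degen e n i xs = take i xs @ [e] @ drop i xs"

definition nerve :: "'a partial_magma \<Rightarrow> 'a list sset" where
  "nerve M = \<lparr>
    simplices = (\<lambda>n. {xs. length xs = n \<and> fully_associable M xs}),
    face = bar_face (\<lambda>x y. the (pmult M x y)),
    degen = bar_degen (punit M)\<rparr>"

text \<open>A simplicial set is a weakly associative partial group if it is isomorphic to the nerve of
  one. An isomorphism from \<open>X\<close> to the nerve of \<open>M\<close> identifies the carrier of \<open>M\<close> with the set of
  1-simplices of \<open>X\<close>; transporting the structure of \<open>M\<close> along this bijection shows that letting
  \<open>M\<close> range over structures on the type of simplices of \<open>X\<close> is no restriction.\<close>

definition is_weakly_associative_partial_group :: "'x sset \<Rightarrow> bool" where
  "is_weakly_associative_partial_group X \<longleftrightarrow>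
    (\<exists>M :: 'x partial_magma. weakly_associative_partial_group M \<and> sset_iso X (nerve M))"

definition group_nerve :: "('a, 'b) monoid_scheme \<Rightarrow> 'a list sset" where
  "group_nerve G = \<lparr>
    simplices = (\<lambda>n. {xs. length xs = n \<and> set xs \<subseteq> carrier G}),
    face = bar_face (mult G),
    degen = bar_degen (one G)\<rparr>"

definition commutative_nerve :: "('a, 'b) monoid_scheme \<Rightarrow> 'a list sset" where
  "commutative_nerve G = (group_nerve G)\<lparr>
    simplices := (\<lambda>n. {xs \<in> simplices (group_nerve G) n.
      \<forall>x\<in>set xs. \<forall>y\<in>set xs. x \<otimes>\<^bsub>G\<^esub> y = y \<otimes>\<^bsub>G\<^esub> x})\<rparr>"

definition torsion_commutative_nerve :: "nat \<Rightarrow> ('a, 'b) monoid_scheme \<Rightarrow> 'a list sset" where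
  "torsion_commutative_nerve d G = (commutative_nerve G)\<lparr>
    simplices := (\<lambda>n. {xs \<in> simplices (commutative_nerve G) n.
      \<forall>x\<in>set xs. x [^]\<^bsub>G\<^esub> d = \<one>\<^bsub>G\<^esub>})\<rparr>"

end

theory Submission
  imports Defs
begin

text \<open>Restrict the multiplication of \<open>G\<close> to commuting pairs. Since \<open>G\<close> is associative, all defined
  bracketings of a tuple agree, so multiplicable tuples are associable. If \<open>(g\<^sub>1, \<dots>, g\<^sub>n)\<close> is fully
  associable, then \<open>g\<^sub>i\<close> commutes with all products \<open>g\<^sub>i\<^sub>+\<^sub>1 \<cdots> g\<^sub>j\<close>, hence by cancellation with every
  \<open>g\<^sub>j\<close>. So the fully associable tuples are exactly the commuting ones, and these stay commuting
  after appending inverses. The same works on the \<open>d\<close>-torsion elements, which are closed under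
  inverses and products of commuting pairs.\<close>

section \<open>Simplicial sets of tuples\<close>

lemma length_bar_face: "length xs = Suc n \<Longrightarrow> i \<le> Suc n \<Longrightarrow> length (bar_face f (Suc n) i xs) = n"
  by (auto simp: bar_face_def)

text \<open>Reading tuples by position turns each simplicial identity into a case distinction on
  \<open>k\<close>. List position \<open>k\<close> holds the entry with index \<open>Suc k\<close>,
  so the product sits at \<open>Suc k = i\<close>. The outer faces fit the same formula:
  \<open>i = 0\<close> always gives the last case, \<open>i = Suc n\<close> always the
  first.\<close>

lemma nth_bar_face:
  assumes "length xs = Suc n" "i \<le> Suc n" "k < n"
  shows "bar_face f (Suc n) i xs ! k =
    (if Suc k < i then xs ! k else if Suc k = i then f (xs ! k) (xs ! Suc k) else xs ! Suc k)"
  using assms by (auto simp: bar_face_def nth_tl nth_butlast nth_append min_def)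

lemma length_bar_degen: "length xs = n \<Longrightarrow> i \<le> n \<Longrightarrow> length (bar_degen e n i xs) = Suc n"
  by (auto simp: bar_degen_def)

lemma nth_bar_degen:
  assumes "length xs = n" "i \<le> n" "k \<le> n"
  shows "bar_degen e n i xs ! k = (if k < i then xs ! k else if k = i then e else xs ! (k - 1))"
  using assms by (auto simp: bar_degen_def nth_append min_def nth_Cons')

text \<open>An upper bound is enough: lying in a given set and commuting pairwise both pass to
  subsets.\<close>

lemma set_bar_face:
  assumes "length xs = Suc n" "i \<le> Suc n"
  shows "set (bar_face f (Suc n) i xs) \<subseteq> set xs \<union> {f x y |x y. x \<in> set xs \<and> y \<in> set xs}"
proof
  fix z assume "z \<in> set (bar_face f (Suc n) i xs)"
  then obtain k where k: "k < n" "z = bar_face f (Suc n) i xs ! k"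
    using assms by (auto simp: in_set_conv_nth length_bar_face)
  have *: "xs ! k \<in> set xs" "xs ! Suc k \<in> set xs"
    using assms k by auto
  moreover have "f (xs ! k) (xs ! Suc k) \<in> {f x y |x y. x \<in> set xs \<and> y \<in> set xs}"
    by (rule CollectI, rule exI[of _ "xs ! k"], rule exI[of _ "xs ! Suc k"]) (simp add: *)
  ultimately show "z \<in> set xs \<union> {f x y |x y. x \<in> set xs \<and> y \<in> set xs}"
    unfolding k(2) nth_bar_face[OF assms k(1)] by (simp only: Un_iff simp_thms split: if_split)
qed

lemma set_bar_degen: "set (bar_degen e n i xs) = insert e (set xs)"
proof -
  have "set (bar_degen e n i xs) = insert e (set (take i xs @ drop i xs))"
    unfolding bar_degen_def set_append by auto
  then show ?thesis unfolding append_take_drop_id .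
qed

text \<open>Compatibility is asked only on entries of \<open>xs\<close>, since a partial
  multiplication will match the group one only on commuting entries.\<close>

lemma map_bar_face:
  assumes "length xs = Suc n" "i \<le> Suc n"
    and "\<And>x y. x \<in> set xs \<Longrightarrow> y \<in> set xs \<Longrightarrow> h (f x y) = g (h x) (h y)"
  shows "map h (bar_face f (Suc n) i xs) = bar_face g (Suc n) i (map h xs)"
  using assms by (intro nth_equalityI) (auto simp: length_bar_face nth_bar_face)

lemma map_bar_degen: "map h (bar_degen e n i xs) = bar_degen (h e) n i (map h xs)"
  by (simp add: bar_degen_def take_map drop_map)

text \<open>Both sides of each identity are compared entrywise. Associativity enters only when two
  adjacent inner faces merge three entries, the unit laws only when a face cancels a
  degeneracy.\<close>

lemma simplicial_set_bar:
  fixes X :: "'a list sset"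
  assumes face: "face X = bar_face f" and degen: "degen X = bar_degen e"
    and len: "\<And>xs n. xs \<in> simplices X n \<Longrightarrow> length xs = n \<and> set xs \<subseteq> A"
    and fc: "\<And>xs n i. xs \<in> simplices X (Suc n) \<Longrightarrow> i \<le> Suc n
      \<Longrightarrow> bar_face f (Suc n) i xs \<in> simplices X n"
    and dc: "\<And>xs n i. xs \<in> simplices X n \<Longrightarrow> i \<le> n \<Longrightarrow> bar_degen e n i xs \<in> simplices X (Suc n)"
    and assoc: "\<And>x y z. x \<in> A \<Longrightarrow> y \<in> A \<Longrightarrow> z \<in> A \<Longrightarrow> f (f x y) z = f x (f y z)"
    and unit: "\<And>x. x \<in> A \<Longrightarrow> f x e = x" "\<And>x. x \<in> A \<Longrightarrow> f e x = x"
  shows "simplicial_set X"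
proof -
  have nth: "xs ! k \<in> A" if "xs \<in> simplices X n" "k < n" for xs n k
    using len[OF that(1)] that(2) by auto
  note simps = length_bar_face nth_bar_face length_bar_degen nth_bar_degen
  show ?thesis
  proof (unfold_locales; unfold face degen)
    fix xs n i j
    assume xs: "xs \<in> simplices X (Suc (Suc n))" and ij: "i < j" "j \<le> Suc (Suc n)"
    have "length xs = Suc (Suc n)" using len[OF xs] by simp
    with ij show "bar_face f (Suc n) i (bar_face f (Suc (Suc n)) j xs)
        = bar_face f (Suc n) (j - 1) (bar_face f (Suc (Suc n)) i xs)"
      by (intro nth_equalityI) (auto simp: simps assoc nth[OF xs] less_Suc_eq_le)
  next
    fix xs n i j
    assume xs: "xs \<in> simplices X n" and ij: "i < j" "j \<le> n"
    \<comment> \<open>The inequalities force \<open>n > 0\<close>; writing \<open>n = Suc m\<close>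
      removes the truncated \<open>n - 1\<close> and makes the inner face an instance of the entry
      formulas.\<close>
    then obtain m where m: "n = Suc m" by (cases n) auto
    have "length xs = Suc m" using len[OF xs] m by simp
    with ij m show "bar_face f (Suc n) i (bar_degen e n j xs)
        = bar_degen e (n - 1) (j - 1) (bar_face f n i xs)"
      by (intro nth_equalityI) (auto simp: simps)
  next
    fix xs n j
    assume xs: "xs \<in> simplices X n" and j: "j \<le> n"
    have "length xs = n" using len[OF xs] by simp
    with j show "bar_face f (Suc n) j (bar_degen e n j xs) = xs"
      by (intro nth_equalityI) (auto simp: simps unit nth[OF xs])
  next
    fix xs n j
    assume xs: "xs \<in> simplices X n" and j: "j \<le> n"
    have "length xs = n" using len[OF xs] by simp
    with j show "bar_face f (Suc n) (Suc j) (bar_degen e n j xs) = xs"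
      by (intro nth_equalityI) (auto simp: simps unit nth[OF xs])
  next
    fix xs n i j
    assume xs: "xs \<in> simplices X n" and ij: "Suc j < i" "i \<le> Suc n"
    then obtain m where m: "n = Suc m" by (cases n) auto
    have "length xs = Suc m" using len[OF xs] m by simp
    with ij m show "bar_face f (Suc n) i (bar_degen e n j xs)
        = bar_degen e (n - 1) j (bar_face f n (i - 1) xs)"
      by (intro nth_equalityI) (auto simp: simps)
  next
    fix xs n i j
    assume xs: "xs \<in> simplices X n" and ij: "i \<le> j" "j \<le> n"
    have "length xs = n" using len[OF xs] by simp
    note len = this
    show "bar_degen e (Suc n) i (bar_degen e n j xs)
        = bar_degen e (Suc n) (Suc j) (bar_degen e n i xs)"
    proof (rule nth_equalityI)
      fix k assume "k < length (bar_degen e (Suc n) i (bar_degen e n j xs))"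
      with len ij have "k \<le> Suc n" by (simp add: length_bar_degen)
      \<comment> \<open>Splitting on \<open>k\<close> removes the truncated \<open>k - 1\<close> of
        \<open>nth_bar_degen\<close>.\<close>
      with len ij show "bar_degen e (Suc n) i (bar_degen e n j xs) ! k
          = bar_degen e (Suc n) (Suc j) (bar_degen e n i xs) ! k"
        by (cases k) (simp_all add: length_bar_degen nth_bar_degen)
    qed (use len ij in \<open>simp add: length_bar_degen\<close>)
  qed (use fc dc in auto)
qed

text \<open>\<open>sset_iso\<close> requires both sides to be simplicial sets. Every simplex of
  \<open>Y\<close> is an image under \<open>f\<close>, and \<open>f\<close> respects the operators,
  so \<open>Y\<close> inherits the identities from \<open>X\<close>; for a nerve this avoids
  computing with the partial operation.\<close>

lemma sset_iso_transport:
  assumes "simplicial_set X"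
    and bij: "\<And>n. bij_betw (f n) (simplices X n) (simplices Y n)"
    and mf: "\<And>x n i. x \<in> simplices X (Suc n) \<Longrightarrow> i \<le> Suc n
      \<Longrightarrow> f n (face X (Suc n) i x) = face Y (Suc n) i (f (Suc n) x)"
    and md: "\<And>x n i. x \<in> simplices X n \<Longrightarrow> i \<le> n
      \<Longrightarrow> f (Suc n) (degen X n i x) = degen Y n i (f n x)"
  shows "sset_iso X Y"
proof -
  interpret X: simplicial_set X by fact
  have Y: "simplices Y n = f n ` simplices X n" for n
    using bij[of n] by (simp add: bij_betw_def)
  have "simplicial_set Y"
  proof
    fix y n i j
    assume "y \<in> simplices Y n" and ij: "i < j" "j \<le> n"
    then obtain x where x: "x \<in> simplices X n" "y = f n x" by (auto simp: Y)
    obtain m where m: "n = Suc m" using ij by (cases n) auto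
    \<comment> \<open>Read from right to left, \<open>mf\<close> and \<open>md\<close> pull each
      operator of \<open>Y\<close> inside \<open>f\<close>, leaving an identity in
      \<open>X\<close>.\<close>
    show "face Y (Suc n) i (degen Y n j y) = degen Y (n - 1) (j - 1) (face Y n i y)"
      using X.face_degen_less[OF x(1) ij] ij x m
      by (simp flip: mf md add: X.face_closed X.degen_closed)
  next
    fix y n i j
    assume "y \<in> simplices Y n" and ij: "Suc j < i" "i \<le> Suc n"
    then obtain x where x: "x \<in> simplices X n" "y = f n x" by (auto simp: Y)
    obtain m where m: "n = Suc m" using ij by (cases n) auto
    show "face Y (Suc n) i (degen Y n j y) = degen Y (n - 1) j (face Y n (i - 1) y)"
      using X.face_degen_greater[OF x(1) ij] ij x m
      by (simp flip: mf md add: X.face_closed X.degen_closed)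
  next
    fix y n i j
    assume "y \<in> simplices Y (Suc (Suc n))" and ij: "i < j" "j \<le> Suc (Suc n)"
    then obtain x where x: "x \<in> simplices X (Suc (Suc n))" "y = f (Suc (Suc n)) x"
      by (auto simp: Y)
    show "face Y (Suc n) i (face Y (Suc (Suc n)) j y)
        = face Y (Suc n) (j - 1) (face Y (Suc (Suc n)) i y)"
      using X.face_face[OF x(1) ij] ij x
      by (simp flip: mf add: X.face_closed)
  next
    fix y n i j
    assume "y \<in> simplices Y n" and ij: "i \<le> j" "j \<le> n"
    then obtain x where x: "x \<in> simplices X n" "y = f n x" by (auto simp: Y)
    show "degen Y (Suc n) i (degen Y n j y) = degen Y (Suc n) (Suc j) (degen Y n i y)"
      using X.degen_degen[OF x(1) ij] ij x
      by (simp flip: md add: X.degen_closed)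
  qed (auto simp: Y simp flip: mf md
      simp: X.face_closed X.degen_closed X.face_degen_same X.face_degen_Suc)
  then have "simplicial_map X Y f"
    using assms by (simp add: simplicial_map_def simplicial_map_axioms_def Y)
  then show ?thesis
    using bij unfolding sset_iso_def by blast
qed

section \<open>The partial group of commuting elements\<close>

definition list_prod :: "('a, 'b) monoid_scheme \<Rightarrow> 'a list \<Rightarrow> 'a" where
  "list_prod G xs = foldr (mult G) xs (one G)"

definition commuting_set :: "('a, 'b) monoid_scheme \<Rightarrow> 'a set \<Rightarrow> bool" where
  "commuting_set G S \<longleftrightarrow> (\<forall>x\<in>S. \<forall>y\<in>S. x \<otimes>\<^bsub>G\<^esub> y = y \<otimes>\<^bsub>G\<^esub> x)"

text \<open>Elements are represented by one-entry lists because
  \<^const>\<open>is_weakly_associative_partial_group\<close> asks for a partial group on the type of simplices.\<close>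

definition commuting_magma :: "('a, 'b) monoid_scheme \<Rightarrow> 'a set \<Rightarrow> 'a list partial_magma" where
  "commuting_magma G C = \<lparr>
    carrier = (\<lambda>x. [x]) ` C,
    pmult = (\<lambda>u v. if hd u \<otimes>\<^bsub>G\<^esub> hd v = hd v \<otimes>\<^bsub>G\<^esub> hd u then Some [hd u \<otimes>\<^bsub>G\<^esub> hd v] else None),
    punit = [\<one>\<^bsub>G\<^esub>]\<rparr>"

text \<open>Treats both nerves at once: \<open>C\<close> will be the whole carrier or the set of
  \<open>d\<close>-torsion elements.\<close>

definition commuting_nerve :: "('a, 'b) monoid_scheme \<Rightarrow> 'a set \<Rightarrow> 'a list sset" where
  "commuting_nerve G C = (group_nerve G)\<lparr>
    simplices := (\<lambda>n. {xs. length xs = n \<and> set xs \<subseteq> C \<and> commuting_set G (set xs)})\<rparr>"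

text \<open>Multiplicability quantifies over bracketings, so extracting information from it needs a
  bracketing of each positive size.\<close>

lemma ex_leaves: "0 < n \<Longrightarrow> \<exists>T. leaves T = n"
proof (induction n)
  case (Suc n)
  show ?case
  proof (cases "n = 0")
    case True
    then show ?thesis by (intro exI[of _ Leaf]) simp
  next
    case False
    with Suc obtain T where "leaves T = n" by auto
    then show ?thesis by (intro exI[of _ "Join Leaf T"]) simp
  qed
qed simp

lemma commuting_set_subset: "commuting_set G S \<Longrightarrow> R \<subseteq> S \<Longrightarrow> commuting_set G R"
  by (auto simp: commuting_set_def)

section \<open>Commutation in a group\<close>

context group
begin

lemma list_prod_simps [simp]:
  "list_prod G [] = \<one>" "list_prod G (x # xs) = x \<otimes> list_prod G xs"
  by (simp_all add: list_prod_def)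

lemma list_prod_closed [simp, intro]: "set xs \<subseteq> carrier G \<Longrightarrow> list_prod G xs \<in> carrier G"
  by (induction xs) auto

lemma list_prod_append:
  "set xs \<subseteq> carrier G \<Longrightarrow> set ys \<subseteq> carrier G
    \<Longrightarrow> list_prod G (xs @ ys) = list_prod G xs \<otimes> list_prod G ys"
  by (induction xs) (auto simp: m_assoc)

lemma commute_mult:
  assumes "x \<in> carrier G" "y \<in> carrier G" "z \<in> carrier G" "x \<otimes> y = y \<otimes> x" "x \<otimes> z = z \<otimes> x"
  shows "x \<otimes> (y \<otimes> z) = (y \<otimes> z) \<otimes> x"
proof -
  have "x \<otimes> (y \<otimes> z) = (y \<otimes> x) \<otimes> z"
    using assms(1-3) by (simp add: m_assoc flip: assms(4))
  also have "\<dots> = (y \<otimes> z) \<otimes> x"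
    using assms(1-3) by (simp add: m_assoc assms(5))
  finally show ?thesis .
qed

text \<open>Cancel \<open>y\<close> on the left in \<open>y x z = x y z = y z x\<close>. This
  recovers commutation with a single factor from commutation with products.\<close>

lemma commute_cancel:
  assumes "x \<in> carrier G" "y \<in> carrier G" "z \<in> carrier G"
    and "x \<otimes> y = y \<otimes> x" "x \<otimes> (y \<otimes> z) = (y \<otimes> z) \<otimes> x"
  shows "x \<otimes> z = z \<otimes> x"
proof -
  have "y \<otimes> (x \<otimes> z) = (x \<otimes> y) \<otimes> z"
    using assms(1-3) by (simp add: m_assoc assms(4))
  also have "\<dots> = y \<otimes> (z \<otimes> x)"
    using assms(1-3,5) by (simp add: m_assoc)
  finally show ?thesis
    using assms(1-3) by simp
qed

lemma commute_inv:
  assumes "x \<in> carrier G" "y \<in> carrier G" "x \<otimes> y = y \<otimes> x"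
  shows "x \<otimes> inv y = inv y \<otimes> x"
  \<comment> \<open>Here \<open>z = inv y\<close>, and \<open>y \<otimes> inv y = \<one>\<close>
    commutes with \<open>x\<close>.\<close>
  by (rule commute_cancel[of x y]) (use assms(1,2) in \<open>simp_all add: assms(3)\<close>)

lemma commute_list_prod:
  "x \<in> carrier G \<Longrightarrow> set ys \<subseteq> carrier G \<Longrightarrow> (\<And>y. y \<in> set ys \<Longrightarrow> x \<otimes> y = y \<otimes> x)
    \<Longrightarrow> x \<otimes> list_prod G ys = list_prod G ys \<otimes> x"
proof (induction ys)
  case (Cons y ys)
  have "x \<otimes> (y \<otimes> list_prod G ys) = (y \<otimes> list_prod G ys) \<otimes> x"
    using Cons.prems(1,2) by (intro commute_mult Cons.prems(3) Cons.IH) simp_all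
  then show ?case by simp
qed simp

lemma list_prod_commute:
  assumes "set xs \<subseteq> carrier G" "set ys \<subseteq> carrier G"
    and "\<And>x y. x \<in> set xs \<Longrightarrow> y \<in> set ys \<Longrightarrow> x \<otimes> y = y \<otimes> x"
  shows "list_prod G xs \<otimes> list_prod G ys = list_prod G ys \<otimes> list_prod G xs"
proof (rule commute_list_prod)
  fix y assume y: "y \<in> set ys"
  then have "y \<otimes> list_prod G xs = list_prod G xs \<otimes> y"
    using assms(1,2) by (intro commute_list_prod assms(3)[symmetric]) auto
  then show "list_prod G xs \<otimes> y = y \<otimes> list_prod G xs" by simp
qed (use assms in auto)

lemma commuting_insert_one: "S \<subseteq> carrier G \<Longrightarrow> commuting_set G S \<Longrightarrow> commuting_set G (insert \<one> S)"
  by (auto simp: commuting_set_def)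

text \<open>By \<open>set_bar_face\<close>, this enlarged set contains the entries of every face of
  a tuple with entries in \<open>S\<close>. Two uses of \<open>commute_mult\<close> handle a pair of
  products.\<close>

lemma commuting_products:
  assumes "S \<subseteq> carrier G" "commuting_set G S"
  shows "commuting_set G (S \<union> {x \<otimes> y |x y. x \<in> S \<and> y \<in> S})"
proof -
  have comm: "x \<otimes> y = y \<otimes> x" if "x \<in> S" "y \<in> S" for x y
    using assms(2) that unfolding commuting_set_def by blast
  have S: "x \<in> carrier G" if "x \<in> S" for x
    using assms(1) that by blast
  have prod: "z \<otimes> (x \<otimes> y) = (x \<otimes> y) \<otimes> z" if "z \<in> S" "x \<in> S" "y \<in> S" for x y z
    by (intro commute_mult comm S that)
  have "(a \<otimes> b) \<otimes> (x \<otimes> y) = (x \<otimes> y) \<otimes> (a \<otimes> b)" if "a \<in> S" "b \<in> S" "x \<in> S" "y \<in> S" for a b x y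
    by (intro commute_mult prod[symmetric] m_closed S that)
  with comm prod prod[symmetric] show ?thesis
    unfolding commuting_set_def by blast
qed

lemma commuting_inverses:
  assumes "S \<subseteq> carrier G" "commuting_set G S"
  shows "commuting_set G (S \<union> m_inv G ` S)"
proof -
  have comm: "x \<otimes> y = y \<otimes> x" if "x \<in> S" "y \<in> S" for x y
    using assms(2) that unfolding commuting_set_def by blast
  have S: "x \<in> carrier G" if "x \<in> S" for x
    using assms(1) that by blast
  have inv: "x \<otimes> inv y = inv y \<otimes> x" if "x \<in> S" "y \<in> S" for x y
    by (intro commute_inv comm S that)
  have "inv x \<otimes> inv y = inv y \<otimes> inv x" if "x \<in> S" "y \<in> S" for x y
    by (intro commute_inv inv[symmetric] inv_closed S that)
  with comm inv inv[symmetric] show ?thesis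
    unfolding commuting_set_def by blast
qed

end

text \<open>\<open>C\<close> need not be a subgroup: closure is asked only for products of commuting
  pairs, as holds for torsion elements of a nonabelian group.\<close>

locale commuting_partial_group = group G for G (structure) +
  fixes C
  assumes C_carrier: "C \<subseteq> carrier G"
    and one_C: "\<one> \<in> C"
    and inv_C: "x \<in> C \<Longrightarrow> inv x \<in> C"
    and mult_C: "x \<in> C \<Longrightarrow> y \<in> C \<Longrightarrow> x \<otimes> y = y \<otimes> x \<Longrightarrow> x \<otimes> y \<in> C"
begin

abbreviation M where "M \<equiv> commuting_magma G C"
abbreviation singletons where "singletons \<equiv> map (\<lambda>x. [x])"

lemma magma_simps [simp]:
  "carrier M = (\<lambda>x. [x]) ` C"
  "punit M = [\<one>]"
  "pmult M [x] [y] = (if x \<otimes> y = y \<otimes> x then Some [x \<otimes> y] else None)"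
  by (simp_all add: commuting_magma_def)

lemma carrier_tupleE:
  assumes "set us \<subseteq> carrier M"
  obtains xs where "us = singletons xs" "set xs \<subseteq> C"
proof
  show "us = singletons (map hd us)"
    using assms by (induction us) auto
  show "set (map hd us) \<subseteq> C"
    using assms by auto
qed

section \<open>Bracketed products\<close>

text \<open>No commutation is assumed: wherever the partial product is defined it is the product in
  \<open>G\<close>, so associativity of \<open>G\<close> fixes the value independently of
  \<open>T\<close>.\<close>

lemma bprod_eq:
  "set xs \<subseteq> C \<Longrightarrow> leaves T = length xs \<Longrightarrow> bprod M T (singletons xs) = Some u
    \<Longrightarrow> u = [list_prod G xs]"
proof (induction T arbitrary: xs u)
  case Leaf
  then show ?case using C_carrier by (cases xs) auto
next
  case (Join S T)
  let ?ys = "take (leaves S) xs" and ?zs = "drop (leaves S) xs"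
  have sub: "set ?ys \<subseteq> C" "set ?zs \<subseteq> C"
    using Join.prems(1) by (auto dest: in_set_takeD in_set_dropD)
  from Join.prems(3) obtain a b where
    a: "bprod M S (singletons ?ys) = Some a" and b: "bprod M T (singletons ?zs) = Some b"
    and u: "pmult M a b = Some u"
    by (auto simp: take_map drop_map bind_eq_Some_conv)
  have "a = [list_prod G ?ys]" "b = [list_prod G ?zs]"
    using Join.IH(1)[OF sub(1) _ a] Join.IH(2)[OF sub(2) _ b] Join.prems(2) by auto
  moreover have "list_prod G xs = list_prod G ?ys \<otimes> list_prod G ?zs"
    using list_prod_append[of ?ys ?zs] sub C_carrier by simp
  ultimately show ?case
    using u by (auto split: if_splits)
qed

text \<open>At each \<open>Join\<close> the two partial products commute because their factors do,
  so the operation is defined there.\<close>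

lemma bprod_commuting:
  "set xs \<subseteq> C \<Longrightarrow> commuting_set G (set xs) \<Longrightarrow> leaves T = length xs
    \<Longrightarrow> bprod M T (singletons xs) = Some [list_prod G xs]"
proof (induction T arbitrary: xs)
  case Leaf
  then show ?case using C_carrier by (cases xs) auto
next
  case (Join S T)
  let ?ys = "take (leaves S) xs" and ?zs = "drop (leaves S) xs"
  have sub: "set ?ys \<subseteq> set xs" "set ?zs \<subseteq> set xs"
    by (auto dest: in_set_takeD in_set_dropD)
  note comm = sub[THEN commuting_set_subset[OF Join.prems(2)]]
  have "bprod M S (singletons ?ys) = Some [list_prod G ?ys]"
    "bprod M T (singletons ?zs) = Some [list_prod G ?zs]"
    using Join.IH(1)[OF _ comm(1)] Join.IH(2)[OF _ comm(2)] Join.prems sub by auto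
  moreover have "list_prod G ?ys \<otimes> list_prod G ?zs = list_prod G ?zs \<otimes> list_prod G ?ys"
    using sub Join.prems C_carrier
    by (intro list_prod_commute) (auto simp: commuting_set_def subset_iff)
  moreover have "list_prod G xs = list_prod G ?ys \<otimes> list_prod G ?zs"
    using list_prod_append[of ?ys ?zs] sub Join.prems(1) C_carrier by auto
  ultimately show ?case
    by (simp add: take_map drop_map)
qed

lemma multiplicable_imp_associable:
  assumes "multiplicable M us"
  shows "associable M us"
proof -
  have "set us \<subseteq> carrier M"
    using assms unfolding multiplicable_def by blast
  then obtain xs where xs: "us = singletons xs" "set xs \<subseteq> C"
    by (rule carrier_tupleE)
  have "bprod M T us = Some [list_prod G xs]" if "leaves T = length us" for T
    using assms that bprod_eq[OF xs(2)] xs(1) by (auto simp: multiplicable_def)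
  with assms show ?thesis by (simp add: associable_def)
qed

lemma associable_commuting:
  assumes "set xs \<subseteq> C" "commuting_set G (set xs)" "2 \<le> length xs"
  shows "associable M (singletons xs)"
  using assms bprod_commuting[OF assms(1,2)]
  by (intro multiplicable_imp_associable) (auto simp: multiplicable_def)

section \<open>Fully associable tuples are the commuting ones\<close>

lemma fully_associable_Cons:
  assumes "fully_associable M (u # us)"
  shows "fully_associable M us"
proof -
  have *: "associable M (take (Suc j - i) (drop i us))" if "i < j" "j < length us" for i j
  proof -
    have "2 \<le> length (u # us)"
      using that by simp
    then have "\<forall>i j. i < j \<and> j < length (u # us)
        \<longrightarrow> associable M (take (Suc j - i) (drop i (u # us)))"
      using assms unfolding fully_associable_def by blast
    \<comment> \<open>The positions \<open>i\<close> to \<open>j\<close> of the tail are the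
      positions \<open>Suc i\<close> to \<open>Suc j\<close> of the whole tuple.\<close>
    from this[rule_format, of "Suc i" "Suc j"] that show ?thesis
      by simp
  qed
  moreover have "associable M us" if "2 \<le> length us"
    using *[of 0 "length us - 1"] that by simp
  moreover have "set us \<subseteq> carrier M"
    using assms unfolding fully_associable_def by simp
  ultimately show ?thesis
    unfolding fully_associable_def by blast
qed

text \<open>Induction handles the tail. The head \<open>x\<close> commutes with the product of every
  prefix of the tail; comparing consecutive prefixes isolates each entry.\<close>

lemma fully_associable_imp_commuting:
  "set xs \<subseteq> C \<Longrightarrow> fully_associable M (singletons xs) \<Longrightarrow> commuting_set G (set xs)"
proof (induction xs)
  case Nil
  then show ?case by (simp add: commuting_set_def)
next
  case (Cons x xs)
  have sub: "x \<in> carrier G" "set xs \<subseteq> carrier G"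
    using Cons.prems(1) C_carrier by auto
  have prefix: "x \<otimes> list_prod G (take k xs) = list_prod G (take k xs) \<otimes> x"
    if "k \<le> length xs" for k
  proof (cases "k = 0")
    case True
    then show ?thesis using sub by simp
  next
    case False
    then obtain T where T: "leaves T = k" using ex_leaves by auto
    \<comment> \<open>The positions 0 to \<open>k\<close> hold \<open>x\<close> and the first
      \<open>k\<close> entries of \<open>xs\<close>; \<open>k > 0\<close> makes this an admissible
      subtuple.\<close>
    have "associable M (take (Suc k - 0) (drop 0 (singletons (x # xs))))"
      using Cons.prems(2) False that unfolding fully_associable_def by fastforce
    \<comment> \<open>This bracketing multiplies \<open>x\<close> in last, so its being defined at
      the root says that \<open>x\<close> commutes with the product of the other entries.\<close>
    then have "bprod M (Join Leaf T) ([x] # singletons (take k xs)) \<noteq> None"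
      using T that by (simp add: associable_def multiplicable_def take_map min_def del: bprod.simps)
    then obtain b where b: "bprod M T (singletons (take k xs)) = Some b" "pmult M [x] b \<noteq> None"
      by (auto simp: bind_eq_None_conv)
    have "b = [list_prod G (take k xs)]"
      using Cons.prems(1) that T by (intro bprod_eq[OF _ _ b(1)]) (auto dest: in_set_takeD)
    with b(2) show ?thesis by (auto split: if_splits)
  qed
  have "x \<otimes> y = y \<otimes> x" if "y \<in> set xs" for y
  proof -
    from that obtain k where k: "k < length xs" "y = xs ! k"
      by (auto simp: in_set_conv_nth)
    have tk: "set (take k xs) \<subseteq> carrier G" and y: "y \<in> carrier G"
      using sub that by (auto dest: in_set_takeD)
    \<comment> \<open>\<open>x\<close> commutes with this product and with its left factor, hence
      with \<open>y\<close> by cancellation.\<close>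
    have "list_prod G (take (Suc k) xs) = list_prod G (take k xs) \<otimes> y"
      using list_prod_append[OF tk, of "[y]"] k y by (simp add: take_Suc_conv_app_nth)
    then show ?thesis
      using prefix[of k] prefix[of "Suc k"] k sub tk y
      by (intro commute_cancel[of x "list_prod G (take k xs)" y]) auto
  qed
  moreover have "commuting_set G (set xs)"
    using Cons fully_associable_Cons by simp
  ultimately show ?case
    by (auto simp: commuting_set_def)
qed

lemma fully_associable_iff:
  assumes "set xs \<subseteq> C"
  shows "fully_associable M (singletons xs) \<longleftrightarrow> commuting_set G (set xs)"
proof
  assume comm: "commuting_set G (set xs)"
  have *: "associable M (take (Suc j - i) (drop i (singletons xs)))"
    if "i < j" "j < length xs" for i j
  proof -
    have sub: "set (take (Suc j - i) (drop i xs)) \<subseteq> set xs"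
      by (auto dest: in_set_takeD in_set_dropD)
    show ?thesis
      using associable_commuting[OF _ commuting_set_subset[OF comm sub]] sub assms that
      by (auto simp: take_map drop_map)
  qed
  show "fully_associable M (singletons xs)"
    using assms associable_commuting[OF assms comm] * by (auto simp: fully_associable_def)
qed (use assms fully_associable_imp_commuting in blast)

section \<open>Inverses and the partial group axioms\<close>

text \<open>\<open>x\<close> and \<open>inv x\<close> commute, so their products are defined;
  uniqueness of inverses in \<open>G\<close> then determines the \<open>THE\<close> in
  \<open>pinverse\<close>.\<close>

lemma is_pinverse_iff:
  assumes "x \<in> C"
  shows "is_pinverse M [x] u \<longleftrightarrow> u = [inv x]"
proof
  assume u: "is_pinverse M [x] u"
  then obtain y where "u = [y]" "y \<in> C" by (auto simp: is_pinverse_def)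
  with u assms C_carrier show "u = [inv x]"
    by (auto simp: is_pinverse_def split: if_splits intro!: inv_equality[symmetric])
qed (use assms C_carrier inv_C in \<open>auto simp: is_pinverse_def subset_iff\<close>)

lemma pinverse_eq: "x \<in> C \<Longrightarrow> pinverse M [x] = [inv x]"
  by (simp add: pinverse_def is_pinverse_iff)

lemma weakly_associative_partial_group: "weakly_associative_partial_group M"
proof
  fix us
  assume us: "fully_associable M us"
  then have "set us \<subseteq> carrier M"
    unfolding fully_associable_def by blast
  then obtain xs where xs: "us = singletons xs" "set xs \<subseteq> C"
    by (rule carrier_tupleE)
  let ?ys = "xs @ rev (map (m_inv G) xs)"
  have "us @ rev (map (pinverse M) us) = singletons ?ys"
    using xs by (auto simp: rev_map pinverse_eq)
  moreover have "commuting_set G (set ?ys)"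
    using us xs C_carrier fully_associable_iff commuting_inverses[of "set xs"] by auto
  moreover have "set ?ys \<subseteq> C"
    using xs inv_C by auto
  ultimately show "fully_associable M (us @ rev (map (pinverse M) us))"
    using fully_associable_iff by metis
next
  fix u v w
  assume "u \<in> carrier M" "v \<in> carrier M" "pmult M u v = Some w"
  then obtain x y where xy: "x \<in> C" "y \<in> C" "x \<otimes> y = y \<otimes> x" and w: "w = [x \<otimes> y]"
    by (auto split: if_splits)
  show "w \<in> carrier M"
    unfolding magma_simps(1) w by (rule imageI) (rule mult_C[OF xy])
next
  fix u
  assume "u \<in> carrier M"
  then obtain x where x: "u = [x]" "x \<in> C" by auto
  then have "x \<in> carrier G" using C_carrier by blast
  then show "pmult M u (punit M) = Some u" "pmult M (punit M) u = Some u"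
    by (simp_all add: x(1))
  show "\<exists>u'. is_pinverse M u u'"
    using x by (simp add: is_pinverse_iff)
qed (simp_all add: one_C multiplicable_imp_associable)

section \<open>Identification of the nerves\<close>

lemma simplices_commuting_nerve:
  "simplices (commuting_nerve G C) n = {xs. length xs = n \<and> set xs \<subseteq> C \<and> commuting_set G (set xs)}"
  by (simp add: commuting_nerve_def)

lemma simplicial_set_commuting_nerve: "simplicial_set (commuting_nerve G C)"
proof (rule simplicial_set_bar[where f = "mult G" and e = \<one> and A = C])
  fix xs n i
  assume xs: "xs \<in> simplices (commuting_nerve G C) (Suc n)" and i: "i \<le> Suc n"
  then have len: "length xs = Suc n" and sub: "set xs \<subseteq> C" and comm: "commuting_set G (set xs)"
    by (auto simp: simplices_commuting_nerve)
  \<comment> \<open>All pairs of entries commute, so the restricted closure \<open>mult_C\<close>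
    applies.\<close>
  have "set xs \<union> {x \<otimes> y |x y. x \<in> set xs \<and> y \<in> set xs} \<subseteq> C"
    using sub comm by (auto simp: commuting_set_def intro!: mult_C)
  moreover have "commuting_set G (set xs \<union> {x \<otimes> y |x y. x \<in> set xs \<and> y \<in> set xs})"
    using sub comm C_carrier by (intro commuting_products) auto
  ultimately show "bar_face (\<otimes>) (Suc n) i xs \<in> simplices (commuting_nerve G C) n"
    unfolding simplices_commuting_nerve
    by (intro CollectI conjI length_bar_face[OF len i] order_trans[OF set_bar_face[OF len i]]
        commuting_set_subset[OF _ set_bar_face[OF len i]])
next
  fix xs n i
  assume "xs \<in> simplices (commuting_nerve G C) n" "i \<le> n"
  then show "bar_degen \<one> n i xs \<in> simplices (commuting_nerve G C) (Suc n)"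
    using one_C C_carrier
    by (auto simp: simplices_commuting_nerve length_bar_degen set_bar_degen
        intro!: commuting_insert_one)
next
  show "face (commuting_nerve G C) = bar_face (\<otimes>)" "degen (commuting_nerve G C) = bar_degen \<one>"
    by (simp_all add: commuting_nerve_def group_nerve_def)
qed (use C_carrier in \<open>auto simp: simplices_commuting_nerve m_assoc subset_iff\<close>)

lemma sset_iso_nerve: "sset_iso (commuting_nerve G C) (nerve M)"
proof (rule sset_iso_transport[where f = "\<lambda>n. singletons"])
  fix n
  have "simplices (nerve M) n = singletons ` simplices (commuting_nerve G C) n"
  proof (intro equalityI subsetI)
    fix us assume us: "us \<in> simplices (nerve M) n"
    then have "set us \<subseteq> carrier M" by (auto simp: nerve_def fully_associable_def)
    then obtain xs where "us = singletons xs" "set xs \<subseteq> C" by (rule carrier_tupleE)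
    with us show "us \<in> singletons ` simplices (commuting_nerve G C) n"
      by (auto simp: nerve_def simplices_commuting_nerve fully_associable_iff)
  qed (auto simp: nerve_def simplices_commuting_nerve fully_associable_iff)
  moreover have "inj_on singletons A" for A
    by (auto intro!: inj_onI dest: map_injective simp: inj_def)
  ultimately show "bij_betw singletons (simplices (commuting_nerve G C) n) (simplices (nerve M) n)"
    by (simp add: bij_betw_def)
next
  fix xs n i
  assume "xs \<in> simplices (commuting_nerve G C) (Suc n)" "i \<le> Suc n"
  \<comment> \<open>On commuting entries \<open>pmult\<close> returns \<open>Some\<close>, so
    \<open>the\<close> yields the product in \<open>G\<close>.\<close>
  then show "singletons (face (commuting_nerve G C) (Suc n) i xs)
      = face (nerve M) (Suc n) i (singletons xs)"
    by (auto simp: commuting_nerve_def group_nerve_def nerve_def commuting_set_def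
        intro!: map_bar_face)
next
  fix xs n i
  show "singletons (degen (commuting_nerve G C) n i xs) = degen (nerve M) n i (singletons xs)"
    by (simp add: commuting_nerve_def group_nerve_def nerve_def map_bar_degen)
qed (rule simplicial_set_commuting_nerve)

lemma is_partial_group_commuting_nerve:
  "is_weakly_associative_partial_group (commuting_nerve G C)"
  unfolding is_weakly_associative_partial_group_def
  by (intro exI[of _ M] conjI weakly_associative_partial_group sset_iso_nerve)

end

section \<open>The full and the torsion commutative nerve\<close>

theorem corollary5p7:
  fixes G :: "('a, 'b) monoid_scheme" and d :: nat
  assumes "group G" and "d \<ge> 2"
  shows "is_weakly_associative_partial_group (commutative_nerve G) \<and>
    is_weakly_associative_partial_group (torsion_commutative_nerve d G)"
proof
  interpret group G by fact
  let ?C = "{x \<in> carrier G. x [^]\<^bsub>G\<^esub> d = \<one>\<^bsub>G\<^esub>}"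
  interpret all: commuting_partial_group G "carrier G"
    by unfold_locales simp_all
  have "commutative_nerve G = commuting_nerve G (carrier G)"
    by (simp add: commutative_nerve_def commuting_nerve_def group_nerve_def commuting_set_def
        conj_assoc)
  then show "is_weakly_associative_partial_group (commutative_nerve G)"
    using all.is_partial_group_commuting_nerve by simp
  interpret torsion: commuting_partial_group G ?C
    \<comment> \<open>For commuting \<open>x\<close> and \<open>y\<close>, the \<open>d\<close>-th
      power of \<open>x \<otimes> y\<close> is the product of the \<open>d\<close>-th powers; this
      gives \<open>mult_C\<close>.\<close>
    by unfold_locales (auto simp: nat_pow_inv pow_mult_distrib)
  have "set xs \<subseteq> ?C \<longleftrightarrow> set xs \<subseteq> carrier G \<and> (\<forall>x\<in>set xs. x [^]\<^bsub>G\<^esub> d = \<one>\<^bsub>G\<^esub>)" for xs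
    by blast
  then have "torsion_commutative_nerve d G = commuting_nerve G ?C"
    by (simp add: torsion_commutative_nerve_def commutative_nerve_def commuting_nerve_def
        group_nerve_def commuting_set_def conj_ac)
  then show "is_weakly_associative_partial_group (torsion_commutative_nerve d G)"
    using torsion.is_partial_group_commuting_nerve by simp
qed

end
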